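(* Let $(X,\mathcal{D})$ be a metric space of finite diameter and covering dimension $\kappa<\infty$, and let $\mathcal{P}_X$ be the set of all probability measures over $X$, equipped with the Wasserstein $W_1$ metric. Then the log-covering dimension of $(\mathcal{P}_X,W_1)$ is $\kappa$.
   Context: $W_1(\nu,\nu')=\inf\mathbb{E}[\mathcal{D}(Y,Y')]$, the infimum over all joint distributions of $(Y,Y')$ on $X\times X$ with marginals $\nu$ and $\nu'$. For a metric space $(Z,\rho)$, $N_r(Z)$ is the minimal number of sets of diameter at most $r$ (respectively strictly less than $r$ in the covering-dimension definition; the two conventions give the same dimensions) covering $Z$. Covering dimension: $\mathrm{COV}(Z)=\inf\{d\ge0:\exists c\ \forall r>0,\ N_r(Z)\le c\,r^{-d}\}$. Log-covering dimension: $\mathrm{LCD}(Z)=\limsup_{r\to0}\frac{\log\log N_r(Z)}{\log(1/r)}$.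
   Formalization: In the covering dimension the bound N_r ≤ c r^{-d} is required only for 0<r≤1 (for all r>0 it fails at large r when d>0, so even [0,1] would have infinite dimension), and log log 1 is read as 0, so that a one-point X has log-covering dimension 0. *)

theory Defs
  imports "HOL-Probability.Probability"
begin

definition ediam :: "('z \<Rightarrow> 'z \<Rightarrow> ennreal) \<Rightarrow> 'z set \<Rightarrow> ennreal" where
  "ediam \<rho> S = (SUP x\<in>S. SUP y\<in>S. \<rho> x y)"

text \<open>Minimal number of subsets of \<open>Z\<close> with property \<open>P\<close> that cover \<open>Z\<close>;
  it is \<open>\<infinity>\<close> if there is no finite cover.\<close>

definition cover_number :: "('z set \<Rightarrow> bool) \<Rightarrow> 'z set \<Rightarrow> enat" where
  "cover_number P Z =
     (INF \<C>\<in>{\<C>. finite \<C> \<and> \<Union>\<C> = Z \<and> (\<forall>S\<in>\<C>. P S)}. enat (card \<C>))"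

definition N_le :: "('z \<Rightarrow> 'z \<Rightarrow> ennreal) \<Rightarrow> 'z set \<Rightarrow> real \<Rightarrow> enat" where
  "N_le \<rho> Z r = cover_number (\<lambda>S. ediam \<rho> S \<le> ennreal r) Z"

definition N_less :: "('z \<Rightarrow> 'z \<Rightarrow> ennreal) \<Rightarrow> 'z set \<Rightarrow> real \<Rightarrow> enat" where
  "N_less \<rho> Z r = cover_number (\<lambda>S. ediam \<rho> S < ennreal r) Z"

text \<open>The scale \<open>r\<close> ranges over \<open>(0,1]\<close>: the covering number of a nonempty space is at least 1,
  so no bound \<open>c * r powr - d\<close> with \<open>d > 0\<close> can hold for arbitrarily large \<open>r\<close>. By monotonicity
  in \<open>r\<close>, any other positive upper limit gives the same dimension.\<close>

definition COV :: "('z \<Rightarrow> 'z \<Rightarrow> ennreal) \<Rightarrow> 'z set \<Rightarrow> ereal" where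
  "COV \<rho> Z = Inf (ereal ` {d. 0 \<le> d \<and>
     (\<exists>c. \<forall>r. 0 < r \<and> r \<le> 1 \<longrightarrow> ereal_of_enat (N_less \<rho> Z r) \<le> ereal (c * r powr (- d)))})"

text \<open>Since \<open>ln 0 = 0\<close>, the value at 1 is 0 (and not \<open>-\<infinity>\<close>). This only matters for the
  log-covering dimension of one-point spaces, which thus is 0.\<close>

definition lnln :: "enat \<Rightarrow> ereal" where
  "lnln N = (case N of enat n \<Rightarrow> ereal (ln (ln (real n))) | \<infinity> \<Rightarrow> \<infinity>)"

definition LCD :: "('z \<Rightarrow> 'z \<Rightarrow> ennreal) \<Rightarrow> 'z set \<Rightarrow> ereal" where
  "LCD \<rho> Z = Limsup (at_right 0) (\<lambda>r::real. lnln (N_le \<rho> Z r) / ereal (ln (1 / r)))"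

definition prob_measures :: "'a::metric_space measure set" where
  "prob_measures = {\<nu>. prob_space \<nu> \<and> sets \<nu> = sets borel}"

definition couplings ::
    "'a::metric_space measure \<Rightarrow> 'a measure \<Rightarrow> ('a \<times> 'a) measure set" where
  "couplings \<nu> \<nu>' = {\<pi>. prob_space \<pi> \<and> sets \<pi> = sets borel \<and>
     distr \<pi> borel fst = \<nu> \<and> distr \<pi> borel snd = \<nu>'}"

definition W1 :: "'a::metric_space measure \<Rightarrow> 'a measure \<Rightarrow> ennreal" where
  "W1 \<nu> \<nu>' = (INF \<pi>\<in>couplings \<nu> \<nu>'. \<integral>\<^sup>+ z. ennreal (dist (fst z) (snd z)) \<partial>\<pi>)"

end

theory Submission
  imports Defs "HOL-Real_Asymp.Real_Asymp"
begin

text \<open>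
  Upper bound: partition \<open>X\<close> into \<open>n \<le> c * r powr (- d)\<close> Borel cells of diameter at most \<open>r\<close> and
  round the cell masses of a measure to multiples of \<open>1 / K\<close> with \<open>K\<close> about \<open>n / r\<close>. Two measures
  with the same rounded masses are coupled by keeping the common mass of each cell inside the cell,
  so their distance is \<open>O(r)\<close>, and there are at most \<open>(K + 1) ^ n\<close> rounded mass vectors.

  Lower bound: if \<open>N r > n\<close>, there are \<open>n + 1\<close> points at mutual distances at least \<open>r / 4\<close>. Fix one
  of them, \<open>x0\<close>. Each subset \<open>B\<close> of the remaining \<open>n\<close> gives the measure obtained from the uniform
  one by moving the mass outside \<open>B\<close> to \<open>x0\<close>. Two such measures at distance at most \<open>r / 64\<close> come
  from subsets differing in at most \<open>n / 4\<close> points, so a set of diameter \<open>r / 64\<close> contains at most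
  \<open>(9/5) ^ n\<close> of these \<open>2 ^ n\<close> measures.
\<close>

subsection \<open>Couplings of measures with close cell masses\<close>

text \<open>Couplings live on the Borel sets of the product space, product measures on the product
  sigma-algebra. Continuity of the projections gives one inclusion. For the other, countably many
  open rectangles form a basis and therefore generate the Borel sets.\<close>

lemma sets_borel_prod_countable_basis:
  fixes B :: "'a::topological_space set set" and C :: "'b::topological_space set set"
  assumes "countable B" "topological_basis B" "countable C" "topological_basis C"
  shows "sets (borel \<Otimes>\<^sub>M borel) = sets (borel :: ('a \<times> 'b) measure)"
proof
  have fs: "fst \<in> borel \<rightarrow>\<^sub>M (borel :: 'a measure)" "snd \<in> borel \<rightarrow>\<^sub>M (borel :: 'b measure)"
    by (intro borel_measurable_continuous_onI continuous_intros)+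
  have "a \<times> b \<in> sets (borel :: ('a \<times> 'b) measure)"
    if "a \<in> sets borel" "b \<in> sets borel" for a :: "'a set" and b :: "'b set"
  proof -
    have "a \<times> b = (fst -` a \<inter> space borel) \<inter> (snd -` b \<inter> space borel)" by auto
    then show ?thesis
      using measurable_sets[OF fs(1) that(1)] measurable_sets[OF fs(2) that(2)] by (metis sets.Int)
  qed
  then have "{a \<times> b |a b. a \<in> sets borel \<and> b \<in> sets borel} \<subseteq> sets (borel :: ('a \<times> 'b) measure)"
    by auto
  from sets.sigma_sets_subset[OF this]
  show "sets (borel \<Otimes>\<^sub>M borel) \<subseteq> sets (borel :: ('a \<times> 'b) measure)"
    by (simp add: sets_pair_measure)
  let ?P = "(\<lambda>(a, b). a \<times> b) ` (B \<times> C)"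
  have "countable ?P" "topological_basis ?P"
    using assms by (auto intro: topological_basis_prod)
  then have "(borel :: ('a \<times> 'b) measure) = sigma UNIV ?P"
    by (rule borel_eq_countable_basis)
  moreover have "?P \<subseteq> sets (borel \<Otimes>\<^sub>M borel)"
    using assms by (auto intro!: pair_measureI simp: topological_basis_open)
  then have "sigma_sets UNIV ?P \<subseteq> sets (borel \<Otimes>\<^sub>M borel)"
    by (metis sets.sigma_sets_subset space_borel space_pair_measure UNIV_Times_UNIV)
  ultimately show "sets (borel :: ('a \<times> 'b) measure) \<subseteq> sets (borel \<Otimes>\<^sub>M borel)"
    by (metis sets_measure_of Pow_UNIV subset_UNIV)
qed

text \<open>The basis consists of the balls of radius \<open>1 / Suc n\<close> around the points of
  a finite \<open>1 / Suc n\<close>-net, for all \<open>n\<close>. A net point close to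
  \<open>x\<close> has its whole ball inside \<open>ball x e\<close> once the radius is below
  \<open>e / 2\<close>.\<close>

lemma countable_basis_if_totally_bounded:
  assumes "\<And>e. e > 0 \<Longrightarrow> \<exists>T. finite T \<and> (\<forall>x::'a::metric_space. \<exists>y\<in>T. dist x y < e)"
  obtains B :: "'a::metric_space set set" where "countable B" "topological_basis B"
proof -
  have "\<exists>T. finite T \<and> (\<forall>x::'a. \<exists>y\<in>T. dist x y < 1 / Suc n)" for n :: nat
    by (rule assms) simp
  then obtain T :: "nat \<Rightarrow> 'a set"
    where T: "\<And>n. finite (T n)" "\<And>n x. \<exists>y\<in>T n. dist x y < 1 / Suc n"
    by metis
  define B where "B = (\<Union>n. (\<lambda>y. ball y (1 / Suc n)) ` T n)"
  have "countable B"
    unfolding B_def using T(1) by (auto intro: countable_finite)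
  moreover have "topological_basis B"
  proof (rule topological_basisI)
    fix U x assume "open U" "(x::'a) \<in> U"
    then obtain e where e: "e > 0" "ball x e \<subseteq> U" using openE by blast
    obtain n where n: "1 / Suc n < e / 2"
      using nat_approx_posE[of "e/2"] e(1) by auto
    obtain y where y: "y \<in> T n" "dist x y < 1 / Suc n" using T(2) by blast
    have "ball y (1 / Suc n) \<subseteq> ball x e"
    proof
      fix z assume "z \<in> ball y (1 / Suc n)"
      then show "z \<in> ball x e"
        using y(2) n dist_triangle[of x z y] by auto
    qed
    then show "\<exists>V\<in>B. x \<in> V \<and> V \<subseteq> U"
      using y e(2) by (intro bexI[of _ "ball y (1 / Suc n)"]) (auto simp: B_def dist_commute)
  qed (auto simp: B_def)
  ultimately show ?thesis by (rule that)
qed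

text \<open>The maximal coupling of two distributions: leave the common mass in place and couple the
  excesses independently. If the excess \<open>t\<close> vanishes then both excess functions do, and the junk
  value of the division by \<open>t\<close> is harmless.\<close>

lemma discrete_coupling:
  fixes p q :: "'i \<Rightarrow> real"
  assumes fin: "finite I" and p: "\<And>i. i \<in> I \<Longrightarrow> 0 \<le> p i" "sum p I = 1"
    and q: "\<And>i. i \<in> I \<Longrightarrow> 0 \<le> q i" "sum q I = 1" and rD: "0 \<le> r" "0 \<le> D"
  obtains c :: "'i \<Rightarrow> 'i \<Rightarrow> real" where
    "\<And>i j. i \<in> I \<Longrightarrow> j \<in> I \<Longrightarrow> 0 \<le> c i j"
    "\<And>i. i \<in> I \<Longrightarrow> (\<Sum>j\<in>I. c i j) = p i"
    "\<And>j. j \<in> I \<Longrightarrow> (\<Sum>i\<in>I. c i j) = q j"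
    "(\<Sum>i\<in>I. \<Sum>j\<in>I. c i j * (if i = j then r else D)) \<le> r + D * (\<Sum>i\<in>I. \<bar>p i - q i\<bar>)"
proof -
  define m where "m i = min (p i) (q i)" for i
  define t where "t = (\<Sum>i\<in>I. p i - m i)"
  define u where "u i j = (p i - m i) * (q j - m j) / t" for i j
  define c where "c i j = (if i = j then m i else 0) + u i j" for i j
  have t2: "t = (\<Sum>i\<in>I. q i - m i)"
    using p(2) q(2) by (simp add: t_def sum_subtractf)
  have t0: "0 \<le> t" unfolding t_def m_def by (intro sum_nonneg) auto
  have z: "p i - m i = 0" "q i - m i = 0" if "t = 0" "i \<in> I" for i
  proof -
    have "0 \<le> p i - m i" "0 \<le> q i - m i" for i by (auto simp: m_def)
    then show "p i - m i = 0" "q i - m i = 0"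
      using that t2 t_def fin by (metis (no_types, lifting) sum_nonneg_eq_0_iff)+
  qed
  have u0: "0 \<le> u i j" for i j
    unfolding u_def using t0 by (auto simp: m_def)
  have u1: "(\<Sum>j\<in>I. u i j) = p i - m i" if "i \<in> I" for i
    using z[OF _ that] by (cases "t = 0") (auto simp: u_def sum_divide_distrib[symmetric]
        sum_distrib_left[symmetric] t2[symmetric])
  have u2: "(\<Sum>i\<in>I. u i j) = q j - m j" if "j \<in> I" for j
    using z[OF _ that] by (cases "t = 0") (auto simp: u_def sum_divide_distrib[symmetric]
        sum_distrib_right[symmetric] t_def[symmetric])
  have c1: "(\<Sum>j\<in>I. c i j) = p i" if "i \<in> I" for i
    using that fin u1 by (simp add: c_def sum.distrib)
  have c2: "(\<Sum>i\<in>I. c i j) = q j" if "j \<in> I" for j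
    using that fin u2 by (simp add: c_def sum.distrib)
  have c0: "0 \<le> c i j" if "i \<in> I" "j \<in> I" for i j
    using u0[of i j] p(1) q(1) that by (auto simp: c_def m_def)
  \<comment> \<open>All mass is charged \<open>r\<close>, and the excess \<open>u\<close>, the only
    mass that may leave its place, is charged \<open>D\<close> on top. The total excess is
    \<open>t\<close>.\<close>
  have "(\<Sum>i\<in>I. \<Sum>j\<in>I. c i j * (if i = j then r else D)) \<le> (\<Sum>i\<in>I. \<Sum>j\<in>I. r * c i j + D * u i j)"
  proof (intro sum_mono)
    fix i j assume "i \<in> I" "j \<in> I"
    then show "c i j * (if i = j then r else D) \<le> r * c i j + D * u i j"
      using rD u0[of i j] c0[of i j] by (auto simp: c_def)
  qed
  also have "\<dots> = r * (\<Sum>i\<in>I. \<Sum>j\<in>I. c i j) + D * (\<Sum>i\<in>I. \<Sum>j\<in>I. u i j)"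
    by (simp add: sum.distrib sum_distrib_left)
  also have "\<dots> = r + D * t"
    using c1 u1 p(2) by (simp add: t_def)
  also have "\<dots> \<le> r + D * (\<Sum>i\<in>I. \<bar>p i - q i\<bar>)"
    using rD unfolding t_def m_def by (intro add_left_mono mult_left_mono sum_mono) auto
  finally show ?thesis using c0 c1 c2 that by blast
qed

lemma nn_integral_finite_index:
  fixes idx :: "'a \<Rightarrow> nat" and g :: "nat \<Rightarrow> ennreal"
  assumes [measurable]: "idx \<in> M \<rightarrow>\<^sub>M count_space UNIV" and "\<And>x. x \<in> space M \<Longrightarrow> idx x < n"
  shows "(\<integral>\<^sup>+x. g (idx x) \<partial>M) = (\<Sum>i<n. g i * emeasure M (idx -` {i} \<inter> space M))"
proof -
  have "(\<integral>\<^sup>+x. g (idx x) \<partial>M) = (\<integral>\<^sup>+x. (\<Sum>i<n. g i * indicator (idx -` {i} \<inter> space M) x) \<partial>M)"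
  proof (rule nn_integral_cong)
    fix x assume "x \<in> space M"
    then have "g (idx x) = (\<Sum>i<n. if i = idx x then g i else 0)"
      using assms(2) by simp
    also have "\<dots> = (\<Sum>i<n. g i * indicator (idx -` {i} \<inter> space M) x)"
      using \<open>x \<in> space M\<close> by (intro sum.cong) (auto simp: indicator_def)
    finally show "g (idx x) = (\<Sum>i<n. g i * indicator (idx -` {i} \<inter> space M) x)" .
  qed
  also have "\<dots> = (\<Sum>i<n. g i * emeasure M (idx -` {i} \<inter> space M))"
    using measurable_sets[OF assms(1)] by (subst nn_integral_sum)
      (auto simp: nn_integral_cmult_indicator intro!: borel_measurable_times_ennreal borel_measurable_indicator)
  finally show ?thesis .
qed

text \<open>A coupling \<open>c\<close> of the cell masses lifts to one of the measures: on the
  product of cells \<open>i\<close> and \<open>j\<close> take the product measure, rescaled to total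
  mass \<open>c i j\<close>. Mass that stays in its cell costs at most \<open>r\<close>, all other
  mass at most \<open>D\<close>.\<close>

lemma W1_le_of_partition:
  fixes \<nu> \<nu>' :: "'a::metric_space measure" and idx :: "'a \<Rightarrow> nat"
  assumes \<nu>: "\<nu> \<in> prob_measures" "\<nu>' \<in> prob_measures"
    and prod: "sets (borel \<Otimes>\<^sub>M borel) = sets (borel :: ('a \<times> 'a) measure)"
    and idx: "idx \<in> borel \<rightarrow>\<^sub>M count_space UNIV" "\<And>x. idx x < n"
    and r: "0 \<le> r" "\<And>x y. idx x = idx y \<Longrightarrow> dist x y \<le> r"
    and D: "0 \<le> D" "\<And>x y :: 'a. dist x y \<le> D"
  shows "W1 \<nu> \<nu>' \<le> ennreal (r + D * (\<Sum>i<n. \<bar>measure \<nu> (idx -` {i}) - measure \<nu>' (idx -` {i})\<bar>))"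
proof -
  interpret P: prob_space \<nu> using \<nu> by (simp add: prob_measures_def)
  interpret P': prob_space \<nu>' using \<nu> by (simp add: prob_measures_def)
  interpret PP: pair_prob_space \<nu> \<nu>' ..
  have sets[measurable_cong, simp]: "sets \<nu> = sets borel" "sets \<nu>' = sets borel"
    using \<nu> by (auto simp: prob_measures_def)
  have space[simp]: "space \<nu> = UNIV" "space \<nu>' = UNIV"
    using sets_eq_imp_space_eq[OF sets(1)] sets_eq_imp_space_eq[OF sets(2)] by auto
  note [measurable] = idx(1)
  have fib: "idx -` {i} \<in> sets borel" for i
    using measurable_sets[OF idx(1), of "{i}"] by simp
  define p where "p i = measure \<nu> (idx -` {i})" for i
  define q where "q i = measure \<nu>' (idx -` {i})" for i
  have pq0: "0 \<le> p i" "0 \<le> q i" for i by (auto simp: p_def q_def)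
  have int1: "(\<integral>\<^sup>+x. ennreal (g (idx x)) \<partial>\<nu>) = ennreal (\<Sum>i<n. g i * p i)"
    if "\<And>i. 0 \<le> g i" for g
    using that by (subst nn_integral_finite_index[where n = n and g = "\<lambda>i. ennreal (g i)"])
      (auto simp: idx p_def P.emeasure_eq_measure ennreal_mult[symmetric] sum_ennreal)
  have int2: "(\<integral>\<^sup>+x. ennreal (g (idx x)) \<partial>\<nu>') = ennreal (\<Sum>i<n. g i * q i)"
    if "\<And>i. 0 \<le> g i" for g
    using that by (subst nn_integral_finite_index[where n = n and g = "\<lambda>i. ennreal (g i)"])
      (auto simp: idx q_def P'.emeasure_eq_measure ennreal_mult[symmetric] sum_ennreal)
  have p1: "sum p {..<n} = 1"
  proof -
    have "ennreal (sum p {..<n}) = 1"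
      using int1[of "\<lambda>_. 1"] P.emeasure_space_1 by simp
    then show ?thesis by simp
  qed
  have q1: "sum q {..<n} = 1"
  proof -
    have "ennreal (sum q {..<n}) = 1"
      using int2[of "\<lambda>_. 1"] P'.emeasure_space_1 by simp
    then show ?thesis by simp
  qed
  obtain c where c: "\<And>i j. i < n \<Longrightarrow> j < n \<Longrightarrow> 0 \<le> c i j"
    "\<And>i. i < n \<Longrightarrow> (\<Sum>j<n. c i j) = p i"
    "\<And>j. j < n \<Longrightarrow> (\<Sum>i<n. c i j) = q j"
    "(\<Sum>i<n. \<Sum>j<n. c i j * (if i = j then r else D)) \<le> r + D * (\<Sum>i<n. \<bar>p i - q i\<bar>)"
    using discrete_coupling[of "{..<n}" p q r D] pq0 p1 q1 r(1) D(1) by auto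
  \<comment> \<open>Rows and columns of null cells carry no mass, so \<open>Hc\<close> holds also
    where \<open>H\<close> takes its default value.\<close>
  have c0: "c i j = 0" if "p i = 0 \<or> q j = 0" "i < n" "j < n" for i j
  proof -
    from that(1) have "(\<Sum>j<n. c i j) = 0 \<or> (\<Sum>i<n. c i j) = 0" using c(2,3) that by auto
    then show ?thesis
      using that c(1) sum_nonneg_eq_0_iff[of "{..<n}" "c i"]
        sum_nonneg_eq_0_iff[of "{..<n}" "\<lambda>i. c i j"] by auto
  qed
  \<comment> \<open>The value on null cells does not affect the coupling; 1 makes \<open>row\<close> and \<open>col\<close> hold for all
    cells, which avoids almost-everywhere arguments for the marginals.\<close>
  define H where "H i j = (if p i = 0 \<or> q j = 0 \<or> i \<ge> n \<or> j \<ge> n then 1 else c i j / (p i * q j))" for i j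
  have H0: "0 \<le> H i j" for i j using c(1) pq0 by (auto simp: H_def)
  have Hc: "p i * q j * H i j = c i j" if "i < n" "j < n" for i j
    using that c0[of i j] by (auto simp: H_def)
  have row: "(\<Sum>j<n. H i j * q j) = 1" if "i < n" for i
  proof (cases "p i = 0")
    case True then show ?thesis using q1 by (simp add: H_def)
  next
    case False
    have "(\<Sum>j<n. H i j * q j) = (\<Sum>j<n. c i j / p i)"
      using that False c0 by (intro sum.cong) (auto simp: H_def)
    also have "\<dots> = 1" using c(2) that False by (simp add: sum_divide_distrib[symmetric])
    finally show ?thesis .
  qed
  have col: "(\<Sum>i<n. H i j * p i) = 1" if "j < n" for j
  proof (cases "q j = 0")
    case True then show ?thesis using p1 by (simp add: H_def)
  next
    case False
    have "(\<Sum>i<n. H i j * p i) = (\<Sum>i<n. c i j / q j)"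
      using that False c0 by (intro sum.cong) (auto simp: H_def)
    also have "\<dots> = 1" using c(3) that False by (simp add: sum_divide_distrib[symmetric])
    finally show ?thesis .
  qed
  define h where "h z = ennreal (H (idx (fst z)) (idx (snd z)))" for z
  define \<pi> where "\<pi> = density (\<nu> \<Otimes>\<^sub>M \<nu>') h"
  have h[measurable]: "h \<in> borel_measurable (\<nu> \<Otimes>\<^sub>M \<nu>')"
    unfolding h_def by measurable
  have sets_\<pi>: "sets \<pi> = sets borel"
    using prod by (simp add: \<pi>_def cong: sets_pair_measure_cong)
  have fst_snd: "fst \<in> \<pi> \<rightarrow>\<^sub>M borel" "snd \<in> \<pi> \<rightarrow>\<^sub>M borel"
    unfolding \<pi>_def by measurable
  have space_\<pi>: "space \<pi> = UNIV" by (simp add: \<pi>_def space_pair_measure)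
  have marg1: "distr \<pi> borel fst = \<nu>"
  proof (rule measure_eqI)
    fix A :: "'a set" assume "A \<in> sets (distr \<pi> borel fst)"
    then have A[measurable]: "A \<in> sets borel" by simp
    have "emeasure (distr \<pi> borel fst) A = emeasure \<pi> (fst -` A \<inter> space \<pi>)"
      using A fst_snd(1) by (rule emeasure_distr[rotated])
    also have "\<dots> = (\<integral>\<^sup>+z. h z * indicator (fst -` A) z \<partial>(\<nu> \<Otimes>\<^sub>M \<nu>'))"
      unfolding \<pi>_def using measurable_sets[OF fst_snd(1) A] space_\<pi>
      by (subst emeasure_density) (auto simp: \<pi>_def)
    also have "\<dots> = (\<integral>\<^sup>+z. h z * indicator A (fst z) \<partial>(\<nu> \<Otimes>\<^sub>M \<nu>'))"
      by (simp add: indicator_def)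
    also have "\<dots> = (\<integral>\<^sup>+x. \<integral>\<^sup>+y. h (x, y) * indicator A x \<partial>\<nu>' \<partial>\<nu>)"
      by (subst P'.nn_integral_fst[symmetric]) auto
    \<comment> \<open>For each fixed \<open>x\<close> the inner integral is the sum in
      \<open>row\<close> for the cell of \<open>x\<close>, which is 1.\<close>
    also have "\<dots> = (\<integral>\<^sup>+x. indicator A x \<partial>\<nu>)"
    proof (rule nn_integral_cong)
      fix x
      have "(\<integral>\<^sup>+y. h (x, y) * indicator A x \<partial>\<nu>') = (\<integral>\<^sup>+y. h (x, y) \<partial>\<nu>') * indicator A x"
        by (rule nn_integral_multc) (auto simp: h_def)
      then show "(\<integral>\<^sup>+y. h (x, y) * indicator A x \<partial>\<nu>') = indicator A x"
        using int2[of "H (idx x)"] H0 row idx(2) by (simp add: h_def)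
    qed
    finally show "emeasure (distr \<pi> borel fst) A = emeasure \<nu> A" by simp
  qed simp
  have marg2: "distr \<pi> borel snd = \<nu>'"
  proof (rule measure_eqI)
    fix A :: "'a set" assume "A \<in> sets (distr \<pi> borel snd)"
    then have A[measurable]: "A \<in> sets borel" by simp
    have "emeasure (distr \<pi> borel snd) A = emeasure \<pi> (snd -` A \<inter> space \<pi>)"
      using A fst_snd(2) by (rule emeasure_distr[rotated])
    also have "\<dots> = (\<integral>\<^sup>+z. h z * indicator (snd -` A) z \<partial>(\<nu> \<Otimes>\<^sub>M \<nu>'))"
      unfolding \<pi>_def using measurable_sets[OF fst_snd(2) A] space_\<pi>
      by (subst emeasure_density) (auto simp: \<pi>_def)
    also have "\<dots> = (\<integral>\<^sup>+z. h z * indicator A (snd z) \<partial>(\<nu> \<Otimes>\<^sub>M \<nu>'))"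
      by (simp add: indicator_def)
    also have "\<dots> = (\<integral>\<^sup>+y. \<integral>\<^sup>+x. h (x, y) * indicator A y \<partial>\<nu> \<partial>\<nu>')"
      by (subst PP.nn_integral_snd[symmetric]) auto
    also have "\<dots> = (\<integral>\<^sup>+y. indicator A y \<partial>\<nu>')"
    proof (rule nn_integral_cong)
      fix y
      have "(\<integral>\<^sup>+x. h (x, y) * indicator A y \<partial>\<nu>) = (\<integral>\<^sup>+x. h (x, y) \<partial>\<nu>) * indicator A y"
        by (rule nn_integral_multc) (auto simp: h_def)
      then show "(\<integral>\<^sup>+x. h (x, y) * indicator A y \<partial>\<nu>) = indicator A y"
        using int1[of "\<lambda>i. H i (idx y)"] H0 col idx(2) by (simp add: h_def)
    qed
    finally show "emeasure (distr \<pi> borel snd) A = emeasure \<nu>' A" by simp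
  qed simp
  have "prob_space \<pi>"
    using P.prob_space_axioms marg1 prob_space_distrD[OF fst_snd(1)] by simp
  then have cpl: "\<pi> \<in> couplings \<nu> \<nu>'"
    using sets_\<pi> marg1 marg2 by (simp add: couplings_def)
  \<comment> \<open>\<open>G\<close> dominates density times distance and depends on the cells only,
    so its integral is a finite sum.\<close>
  define G where "G i j = H i j * (if i = j then r else D)" for i j
  have G0: "0 \<le> G i j" for i j using H0 r D by (simp add: G_def)
  \<comment> \<open>The distance is continuous and hence Borel on the product; measurability for the
    product sigma-algebra comes from \<open>prod\<close>, through \<open>sets_\<pi>\<close>.\<close>
  have dm: "(\<lambda>z. ennreal (dist (fst z) (snd z))) \<in> borel_measurable \<pi>"
    unfolding measurable_cong_sets[OF sets_\<pi> refl]
    by (intro measurable_compose[OF _ measurable_ennreal] borel_measurable_continuous_onI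
        continuous_intros)
  have dm': "(\<lambda>z. ennreal (dist (fst z) (snd z))) \<in> borel_measurable (\<nu> \<Otimes>\<^sub>M \<nu>')"
    using dm by (simp add: \<pi>_def)
  have "W1 \<nu> \<nu>' \<le> (\<integral>\<^sup>+z. ennreal (dist (fst z) (snd z)) \<partial>\<pi>)"
    unfolding W1_def using cpl by (rule INF_lower)
  also have "\<dots> = (\<integral>\<^sup>+z. h z * ennreal (dist (fst z) (snd z)) \<partial>(\<nu> \<Otimes>\<^sub>M \<nu>'))"
    unfolding \<pi>_def by (rule nn_integral_density[OF h dm'])
  also have "\<dots> \<le> (\<integral>\<^sup>+z. ennreal (G (idx (fst z)) (idx (snd z))) \<partial>(\<nu> \<Otimes>\<^sub>M \<nu>'))"
    using H0 r D by (intro nn_integral_mono)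
      (auto simp: h_def G_def ennreal_mult[symmetric] intro!: ennreal_leI mult_left_mono)
  also have "\<dots> = (\<integral>\<^sup>+x. \<integral>\<^sup>+y. ennreal (G (idx x) (idx y)) \<partial>\<nu>' \<partial>\<nu>)"
    by (subst P'.nn_integral_fst[symmetric]) auto
  also have "\<dots> = ennreal (\<Sum>i<n. (\<Sum>j<n. G i j * q j) * p i)"
    using int2[of "G (idx _)"] int1[of "\<lambda>i. \<Sum>j<n. G i j * q j"] G0 pq0
    by (simp add: sum_nonneg)
  also have "(\<Sum>i<n. (\<Sum>j<n. G i j * q j) * p i) = (\<Sum>i<n. \<Sum>j<n. c i j * (if i = j then r else D))"
    unfolding sum_distrib_right
    by (intro sum.cong refl) (auto simp: G_def Hc[symmetric])
  also have "ennreal \<dots> \<le> ennreal (r + D * (\<Sum>i<n. \<bar>p i - q i\<bar>))"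
    using c(4) by (rule ennreal_leI)
  finally show ?thesis by (simp add: p_def q_def)
qed

subsection \<open>Measures on a separated set\<close>

text \<open>This is the easy half of Kantorovich duality: integrate the Lipschitz inequality against
  any coupling. A test function with integral 0 under \<open>\<nu>'\<close> avoids subtraction in
  \<open>ennreal\<close>.\<close>

lemma W1_ge_nn_integral:
  fixes f :: "'a::metric_space \<Rightarrow> real"
  assumes cont: "continuous_on UNIV f" and f0: "\<And>x. 0 \<le> f x"
    and lip: "\<And>x y. f x \<le> f y + dist x y"
    and null: "(\<integral>\<^sup>+x. ennreal (f x) \<partial>\<nu>') = 0"
  shows "(\<integral>\<^sup>+x. ennreal (f x) \<partial>\<nu>) \<le> W1 \<nu> \<nu>'"
  unfolding W1_def
proof (rule INF_greatest)
  fix \<pi> assume "\<pi> \<in> couplings \<nu> \<nu>'"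
  then have [measurable_cong]: "sets \<pi> = sets borel"
    and marg: "distr \<pi> borel fst = \<nu>" "distr \<pi> borel snd = \<nu>'"
    by (auto simp: couplings_def)
  have [measurable]: "(\<lambda>x. ennreal (f x)) \<in> borel_measurable borel"
    by (intro measurable_compose[OF _ measurable_ennreal] borel_measurable_continuous_onI cont)
  have fs[measurable]: "fst \<in> \<pi> \<rightarrow>\<^sub>M borel" "snd \<in> \<pi> \<rightarrow>\<^sub>M borel"
    unfolding measurable_cong_sets[OF \<open>sets \<pi> = sets borel\<close> refl]
    by (intro borel_measurable_continuous_onI continuous_intros)+
  have [measurable]: "(\<lambda>z. ennreal (dist (fst z) (snd z))) \<in> borel_measurable \<pi>"
    unfolding measurable_cong_sets[OF \<open>sets \<pi> = sets borel\<close> refl]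
    by (intro measurable_compose[OF _ measurable_ennreal] borel_measurable_continuous_onI
        continuous_intros)
  have "(\<integral>\<^sup>+x. ennreal (f x) \<partial>\<nu>) = (\<integral>\<^sup>+z. ennreal (f (fst z)) \<partial>\<pi>)"
    unfolding marg(1)[symmetric] by (rule nn_integral_distr) measurable
  also have "\<dots> \<le> (\<integral>\<^sup>+z. ennreal (f (snd z)) + ennreal (dist (fst z) (snd z)) \<partial>\<pi>)"
    using f0 lip by (intro nn_integral_mono) (auto simp flip: ennreal_plus intro!: ennreal_leI)
  also have "\<dots> = (\<integral>\<^sup>+z. ennreal (f (snd z)) \<partial>\<pi>) + (\<integral>\<^sup>+z. ennreal (dist (fst z) (snd z)) \<partial>\<pi>)"
    by (rule nn_integral_add) measurable
  also have "(\<integral>\<^sup>+z. ennreal (f (snd z)) \<partial>\<pi>) = (\<integral>\<^sup>+x. ennreal (f x) \<partial>\<nu>')"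
    unfolding marg(2)[symmetric] by (rule nn_integral_distr[symmetric]) measurable
  finally show "(\<integral>\<^sup>+x. ennreal (f x) \<partial>\<nu>) \<le> (\<integral>\<^sup>+z. ennreal (dist (fst z) (snd z)) \<partial>\<pi>)"
    using null by simp
qed

text \<open>As a push-forward of the uniform distribution this is at once a Borel probability
  measure, and its integrals are averages over \<open>P\<close>.\<close>

definition redirect :: "'a::metric_space set \<Rightarrow> 'a \<Rightarrow> 'a set \<Rightarrow> 'a measure" where
  "redirect P x0 B = distr (measure_pmf (pmf_of_set P)) borel (\<lambda>x. if x \<in> B then x else x0)"

lemma redirect_in_prob_measures: "redirect P x0 B \<in> prob_measures"
  unfolding prob_measures_def redirect_def
  by (auto intro!: prob_space.prob_space_distr measure_pmf.prob_space_axioms)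

lemma nn_integral_redirect:
  assumes "finite P" "P \<noteq> {}" "g \<in> borel_measurable borel"
  shows "(\<integral>\<^sup>+x. g x \<partial>redirect P x0 B) = (\<Sum>x\<in>P. g (if x \<in> B then x else x0)) / card P"
  unfolding redirect_def using assms
  by (subst nn_integral_distr) (auto simp: nn_integral_pmf_of_set)

text \<open>The test function is the distance to \<open>insert x0 B'\<close>, where the second
  measure lives. It is at least \<open>s\<close> on \<open>B - B'\<close>, because these points also
  differ from \<open>x0\<close>, and each of them has mass at least \<open>1 / card P\<close> under
  the first measure.\<close>

lemma W1_redirect_ge:
  assumes P: "finite P" "x0 \<in> P" and s: "0 \<le> s"
    and sep: "\<And>x y. x \<in> P \<Longrightarrow> y \<in> P \<Longrightarrow> x \<noteq> y \<Longrightarrow> s \<le> dist x y"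
    and B: "B \<subseteq> P - {x0}" "B' \<subseteq> P - {x0}"
  shows "ennreal (s * card (B - B') / card P) \<le> W1 (redirect P x0 B) (redirect P x0 B')"
proof -
  define S where "S = insert x0 B'"
  define f where "f x = infdist x S" for x
  have cont: "continuous_on UNIV f" unfolding f_def by (intro continuous_intros)
  have [measurable]: "(\<lambda>x. ennreal (f x)) \<in> borel_measurable borel"
    by (intro measurable_compose[OF _ measurable_ennreal] borel_measurable_continuous_onI cont)
  note int = nn_integral_redirect[where P = P and g = "\<lambda>x. ennreal (f x)"]
  have "f (if x \<in> B' then x else x0) = 0" for x
    by (simp add: f_def S_def)
  then have null: "(\<integral>\<^sup>+x. ennreal (f x) \<partial>redirect P x0 B') = 0"
    using P by (subst int) auto
  have far: "s \<le> f x" if "x \<in> B - B'" for x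
  proof -
    have "s \<le> (INF y\<in>S. dist x y)"
    proof (rule cINF_greatest)
      fix y assume "y \<in> S"
      then show "s \<le> dist x y" using that B P sep by (auto simp: S_def)
    qed (simp add: S_def)
    then show ?thesis by (simp add: f_def infdist_def S_def)
  qed
  have "ennreal (s * card (B - B') / card P) = (\<Sum>x\<in>B - B'. ennreal s) / card P"
    using s P by (auto simp: ennreal_of_nat_eq_real_of_nat card_gt_0_iff mult.commute
        simp flip: ennreal_mult intro!: divide_ennreal[symmetric])
  also have "\<dots> \<le> (\<Sum>x\<in>B - B'. ennreal (f (if x \<in> B then x else x0))) / card P"
    using far by (intro divide_right_mono_ennreal sum_mono) (auto intro: ennreal_leI)
  also have "\<dots> \<le> (\<Sum>x\<in>P. ennreal (f (if x \<in> B then x else x0))) / card P"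
    using B P by (intro divide_right_mono_ennreal sum_mono2) auto
  also have "\<dots> = (\<integral>\<^sup>+x. ennreal (f x) \<partial>redirect P x0 B)"
    using P by (subst int) auto
  also have "\<dots> \<le> W1 (redirect P x0 B) (redirect P x0 B')"
    using cont null by (intro W1_ge_nn_integral) (auto simp: f_def infdist_triangle infdist_nonneg)
  finally show ?thesis .
qed

text \<open>Chernoff bound: weigh each subset \<open>A\<close> by \<open>(1/2) ^ card A\<close>; the total weight is
  \<open>(3/2) ^ n\<close>, and a subset of size at most \<open>n / 4\<close> has weight at least \<open>(5/6) ^ n\<close>,
  since \<open>(5/6) ^ 4 \<le> 1/2\<close>.\<close>

lemma card_small_subsets_le:
  assumes "finite Q"
  shows "real (card {A \<in> Pow Q. 4 * card A \<le> card Q}) \<le> (9/5) ^ card Q"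
proof -
  let ?F = "{A \<in> Pow Q. 4 * card A \<le> card Q}"
  have "(5/6) ^ card Q \<le> (1/2 :: real) ^ card A" if "A \<in> ?F" for A
  proof -
    have "(5/6 :: real) ^ card Q \<le> (5/6) ^ (4 * card A)"
      using that by (intro power_decreasing) auto
    also have "\<dots> = ((5/6) ^ 4) ^ card A" by (simp add: power_mult)
    also have "\<dots> \<le> (1/2) ^ card A" by (intro power_mono) (auto simp: power_divide)
    finally show ?thesis .
  qed
  then have "real (card ?F) * (5/6) ^ card Q \<le> (\<Sum>A\<in>?F. (1/2) ^ card A)"
    by (intro sum_bounded_below) auto
  also have "\<dots> \<le> (\<Sum>A\<in>Pow Q. (1/2) ^ card A)"
    using assms by (intro sum_mono2) auto
  also have "\<dots> = (3/2) ^ card Q"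
    \<comment> \<open>Expanding the product of \<open>1/2 + 1\<close> over \<open>Q\<close> yields
      one summand for each subset.\<close>
    using prod_add[OF assms, of "\<lambda>_. 1/2 :: real" "\<lambda>_. 1"] by simp
  finally have "real (card ?F) \<le> (3/2) ^ card Q / (5/6) ^ card Q"
    by (simp add: pos_le_divide_eq)
  also have "\<dots> = ((3/2) / (5/6)) ^ card Q" by (simp only: power_divide)
  finally show ?thesis by simp
qed

subsection \<open>Covering numbers\<close>

lemma ediam_leD: "ediam \<rho> S \<le> b \<Longrightarrow> x \<in> S \<Longrightarrow> y \<in> S \<Longrightarrow> \<rho> x y \<le> b"
  unfolding ediam_def by (meson SUP_le_iff)

lemma ediam_leI: "(\<And>x y. x \<in> S \<Longrightarrow> y \<in> S \<Longrightarrow> \<rho> x y \<le> b) \<Longrightarrow> ediam \<rho> S \<le> b"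
  unfolding ediam_def by (intro SUP_least)

lemma cover_number_leE:
  assumes "cover_number Pr Z \<le> enat n"
  obtains C where "finite C" "\<Union>C = Z" "\<And>S. S \<in> C \<Longrightarrow> Pr S" "card C \<le> n"
proof -
  \<comment> \<open>The strict bound makes some cover in the infimum smaller than
    \<open>Suc n\<close>, so no separate argument for attainment is needed.\<close>
  have "cover_number Pr Z < enat (Suc n)" using assms by (simp add: order_le_less_trans)
  then show ?thesis
    unfolding cover_number_def INF_less_iff by (auto intro: that)
qed

lemma cover_number_leI:
  assumes "finite C" "\<Union>C = Z" "\<And>S. S \<in> C \<Longrightarrow> Pr S" "card C \<le> n"
  shows "cover_number Pr Z \<le> enat n"
proof -
  have "cover_number Pr Z \<le> enat (card C)"
    unfolding cover_number_def using assms by (intro INF_lower) auto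
  then show ?thesis using assms(4) order_trans by fastforce
qed

text \<open>Subsets are counted rather than measures: \<open>F S\<close> collects the subsets whose
  measure lies in \<open>S\<close>. These families cover all \<open>2 ^ n\<close> subsets and have
  at most \<open>(9/5) ^ n\<close> members each; the ratio of the bases is
  \<open>10/9\<close>.\<close>

lemma card_W1_cover_ge:
  fixes P :: "'a::metric_space set"
  assumes P: "finite P" "card P = Suc n" "n \<ge> 1" and s: "0 < s"
    and sep: "\<And>x y. x \<in> P \<Longrightarrow> y \<in> P \<Longrightarrow> x \<noteq> y \<Longrightarrow> s \<le> dist x y"
    and C: "finite C" "\<Union>C = (prob_measures :: 'a measure set)"
    and small: "\<And>S. S \<in> C \<Longrightarrow> ediam W1 S \<le> ennreal (s / 16)"
  shows "(10/9) ^ n \<le> real (card C)"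
proof -
  obtain x0 where x0: "x0 \<in> P" using P by fastforce
  define Q where "Q = P - {x0}"
  have Q: "finite Q" "card Q = n" using P x0 by (auto simp: Q_def)
  define F where "F S = {B \<in> Pow Q. redirect P x0 B \<in> S}" for S
  have close: "8 * card (B - B') \<le> n" if "S \<in> C" "B \<in> F S" "B' \<in> F S" for S B B'
  proof -
    have "ennreal (s * card (B - B') / card P) \<le> W1 (redirect P x0 B) (redirect P x0 B')"
      using that s x0 P sep by (intro W1_redirect_ge) (auto simp: F_def Q_def)
    also have "\<dots> \<le> ennreal (s / 16)"
      using that small by (intro ediam_leD[of W1 S]) (auto simp: F_def)
    finally have "s * card (B - B') / (1 + real n) \<le> s / 16"
      using s P(2) by (simp add: ennreal_le_iff)
    then have "s * (16 * card (B - B')) \<le> s * (1 + real n)"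
      by (simp add: field_simps)
    then have "16 * real (card (B - B')) \<le> 1 + real n" using s by simp
    \<comment> \<open>The number of points is \<open>n + 1\<close>, and
      \<open>n + 1 <= 2 * n\<close> because \<open>n >= 1\<close>.\<close>
    then show ?thesis using P(3) by linarith
  qed
  have cF: "real (card (F S)) \<le> (9/5) ^ n" if "S \<in> C" for S
  proof (cases "F S = {}")
    case False
    then obtain B0 where B0: "B0 \<in> F S" by blast
    \<comment> \<open>Symmetric difference with a fixed member is injective. Its two halves have at
      most \<open>n / 8\<close> points each, so the images are the small subsets of the Chernoff
      bound.\<close>
    let ?f = "\<lambda>B. (B - B0) \<union> (B0 - B)"
    have "inj_on ?f (F S)" by (rule inj_onI) blast
    moreover have "?f ` F S \<subseteq> {A \<in> Pow Q. 4 * card A \<le> card Q}"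
    proof clarsimp
      fix B assume B: "B \<in> F S"
      have "card (?f B) \<le> card (B - B0) + card (B0 - B)" by (rule card_Un_le)
      then have "4 * card (?f B) \<le> n"
        using close[OF that B B0] close[OF that B0 B] by linarith
      then show "B - B0 \<subseteq> Q \<and> B0 - B \<subseteq> Q \<and> 4 * card (?f B) \<le> card Q"
        using B B0 Q by (auto simp: F_def)
    qed
    ultimately have "card (F S) \<le> card {A \<in> Pow Q. 4 * card A \<le> card Q}"
      using Q(1) by (intro card_inj_on_le) auto
    then show ?thesis using card_small_subsets_le[OF Q(1)] Q(2) by (simp add: order_trans)
  qed simp
  have "Pow Q \<subseteq> (\<Union>S\<in>C. F S)"
    using C(2) redirect_in_prob_measures[of P x0] by (auto simp: F_def)
  then have "card (Pow Q) \<le> card (\<Union>S\<in>C. F S)"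
    using C Q by (intro card_mono) (auto simp: F_def)
  also have "\<dots> \<le> (\<Sum>S\<in>C. card (F S))" using C(1) by (rule card_UN_le)
  finally have "real (2 ^ n) \<le> real (\<Sum>S\<in>C. card (F S))"
    using Q by (simp only: card_Pow of_nat_le_iff)
  also have "\<dots> \<le> real (card C) * (9/5) ^ n"
    unfolding of_nat_sum using cF by (rule sum_bounded_above)
  finally have "2 ^ n / (9/5) ^ n \<le> real (card C)"
    by (simp add: pos_divide_le_eq)
  moreover have "(2 :: real) ^ n / (9/5) ^ n = (2 / (9/5)) ^ n" by (simp only: power_divide)
  ultimately show ?thesis by simp
qed

text \<open>Points are added greedily. If at most \<open>n\<close> points cannot be extended, the
  balls of radius \<open>r / 4\<close> around them cover the space, contradicting the covering
  number. Radius \<open>r / 4\<close> leaves room for the strict diameter bound in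
  \<open>N_less\<close>.\<close>

lemma separated_set_exists:
  assumes r: "0 < r" and "enat n < N_less (\<lambda>x y :: 'a::metric_space. ennreal (dist x y)) UNIV r"
  shows "\<exists>P :: 'a set. finite P \<and> card P = Suc n \<and> (\<forall>x\<in>P. \<forall>y\<in>P. x \<noteq> y \<longrightarrow> r / 4 \<le> dist x y)"
proof -
  have "\<exists>P :: 'a set. finite P \<and> card P = k \<and> (\<forall>x\<in>P. \<forall>y\<in>P. x \<noteq> y \<longrightarrow> r / 4 \<le> dist x y)"
    if "k \<le> Suc n" for k
    using that
  proof (induction k)
    case 0
    then show ?case by (intro exI[of _ "{}"]) auto
  next
    case (Suc k)
    then obtain P :: "'a set" where P: "finite P" "card P = k"
      "\<forall>x\<in>P. \<forall>y\<in>P. x \<noteq> y \<longrightarrow> r / 4 \<le> dist x y" by auto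
    have "\<exists>z. \<forall>x\<in>P. r / 4 \<le> dist x z"
    proof (rule ccontr)
      assume "\<nexists>z. \<forall>x\<in>P. r / 4 \<le> dist x z"
      then have cov: "\<Union>((\<lambda>x. ball x (r / 4)) ` P) = UNIV" by (auto simp: not_le)
      have "ediam (\<lambda>x y. ennreal (dist x y)) (ball x (r / 4)) < ennreal r" for x :: 'a
      proof -
        have "ediam (\<lambda>x y. ennreal (dist x y)) (ball x (r / 4)) \<le> ennreal (r / 2)"
        proof (intro ediam_leI ennreal_leI)
          fix y z assume "y \<in> ball x (r / 4)" "z \<in> ball x (r / 4)"
          then show "dist y z \<le> r / 2" using dist_triangle3[of y z x] by auto
        qed
        also have "\<dots> < ennreal r" using r by (simp add: ennreal_less_iff)
        finally show ?thesis .
      qed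
      then have "N_less (\<lambda>x y :: 'a. ennreal (dist x y)) UNIV r \<le> enat n"
        unfolding N_less_def using P cov Suc.prems card_image_le[OF P(1), of "\<lambda>x. ball x (r / 4)"]
        by (intro cover_number_leI[of "(\<lambda>x. ball x (r / 4)) ` P"]) auto
      then show False using assms(2) by simp
    qed
    then obtain z where z: "\<forall>x\<in>P. r / 4 \<le> dist x z" by blast
    then have "z \<notin> P" using r by force
    then show ?case
      using P z by (intro exI[of _ "insert z P"]) (auto simp: dist_commute)
  qed
  then show ?thesis by simp
qed

lemma W1_covering_number_le:
  assumes r: "0 < r" and N: "N_less (\<lambda>x y :: 'a::metric_space. ennreal (dist x y)) UNIV r \<le> enat n"
    and prod: "sets (borel \<Otimes>\<^sub>M borel) = sets (borel :: ('a \<times> 'a) measure)"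
    and D: "0 \<le> D" "\<And>x y :: 'a. dist x y \<le> D" and K: "K > 0"
  shows "N_le W1 (prob_measures :: 'a measure set) (r + D * (n / real K)) \<le> enat ((K + 1) ^ n)"
proof -
  obtain C :: "'a set set" where C: "finite C" "\<Union>C = UNIV"
    "\<And>S. S \<in> C \<Longrightarrow> ediam (\<lambda>x y. ennreal (dist x y)) S < ennreal r" "card C \<le> n"
    using cover_number_leE[OF N[unfolded N_less_def]] by metis
  obtain f where f: "bij_betw f {0..<card C} C"
    using ex_bij_betw_nat_finite[OF C(1)] by blast
  \<comment> \<open>The sets of the cover need not be Borel. Their closures are, and keep the
    diameter bound \<open>r\<close>; the first closure containing a point then defines disjoint
    Borel cells.\<close>
  define F where "F i = (if i < card C then closure (f i) else {})" for i
  have diam: "dist x y \<le> r" if "x \<in> F i" "y \<in> F i" for x y i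
  proof -
    have i: "i < card C" "x \<in> closure (f i)" "y \<in> closure (f i)"
      using that by (auto simp: F_def split: if_splits)
    have "f i \<in> C" using f i(1) by (auto simp: bij_betw_def)
    then have "dist a b \<le> r" if "a \<in> f i" "b \<in> f i" for a b
      using ediam_leD[OF less_imp_le[OF C(3)] that] r by simp
    \<comment> \<open>Closed balls contain closures of their subsets. This is used twice, first with
      a centre in \<open>f i\<close> and then with the centre \<open>x\<close> in the
      closure.\<close>
    then have "f i \<subseteq> cball a r" if "a \<in> f i" for a using that by auto
    then have "closure (f i) \<subseteq> cball a r" if "a \<in> f i" for a
      using that by (simp add: closure_minimal)
    then have "f i \<subseteq> cball x r" using i by (force simp: dist_commute)
    then have "closure (f i) \<subseteq> cball x r" by (simp add: closure_minimal)
    then show ?thesis using i by auto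
  qed
  have ex: "\<exists>i<card C. x \<in> F i" for x
  proof -
    obtain S where "S \<in> C" "x \<in> S" using C(2) by blast
    moreover have "S \<in> f ` {0..<card C}" using f \<open>S \<in> C\<close> by (simp add: bij_betw_def)
    ultimately obtain i where "i < card C" "f i = S" by auto
    then show ?thesis using \<open>x \<in> S\<close> closure_subset by (auto simp: F_def intro!: exI[of _ i])
  qed
  define idx where "idx x = (LEAST i. x \<in> F i)" for x
  have idx_in: "x \<in> F (idx x)" for x
    unfolding idx_def using ex[of x] by (auto intro: LeastI)
  have idx_less: "idx x < n" for x
  proof -
    from ex obtain i where "i < card C" "x \<in> F i" by blast
    then have "idx x \<le> i" unfolding idx_def by (intro Least_le)
    then show ?thesis using \<open>i < card C\<close> C(4) by simp
  qed
  have [measurable]: "F i \<in> sets borel" for i by (auto simp: F_def)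
  have idx_meas: "idx \<in> borel \<rightarrow>\<^sub>M count_space UNIV"
    unfolding idx_def by measurable
  \<comment> \<open>The cell masses are rounded down to multiples of \<open>1 / K\<close>. Being at
    most 1, they give numerators in \<open>{..K}\<close>, hence the count
    \<open>(K + 1) ^ n\<close>.\<close>
  define a :: "'a measure \<Rightarrow> nat \<Rightarrow> nat"
    where "a \<nu> i = nat \<lfloor>K * measure \<nu> (idx -` {i})\<rfloor>" for \<nu> i
  define cell where "cell v = {\<nu> \<in> prob_measures. \<forall>i<n. a \<nu> i = v i}" for v
  define V where "V = {..<n} \<rightarrow>\<^sub>E {..K}"
  have V: "finite V" "card V = (K + 1) ^ n"
    by (auto simp: V_def card_PiE intro!: finite_PiE)
  have "\<nu> \<in> \<Union>(cell ` V)" if "\<nu> \<in> prob_measures" for \<nu> :: "'a measure"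
  proof
    interpret prob_space \<nu> using that by (simp add: prob_measures_def)
    have "a \<nu> i \<le> K" for i
    proof -
      have "K * measure \<nu> (idx -` {i}) \<le> real K * 1" by (intro mult_left_mono) auto
      then show ?thesis unfolding a_def by linarith
    qed
    then show "restrict (a \<nu>) {..<n} \<in> V" by (auto simp: V_def)
    show "\<nu> \<in> cell (restrict (a \<nu>) {..<n})" using that by (auto simp: cell_def)
  qed
  then have cov: "\<Union>(cell ` V) = prob_measures" by (auto simp: cell_def)
  have "ediam W1 (cell v) \<le> ennreal (r + D * (n / real K))" for v
  proof (rule ediam_leI)
    fix \<nu> \<nu>' assume \<nu>: "\<nu> \<in> cell v" "\<nu>' \<in> cell v"
    have near: "\<bar>measure \<nu> (idx -` {i}) - measure \<nu>' (idx -` {i})\<bar> \<le> 1 / K" if "i < n" for i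
    proof -
      have "nat \<lfloor>K * measure \<nu> (idx -` {i})\<rfloor> = nat \<lfloor>K * measure \<nu>' (idx -` {i})\<rfloor>"
        using \<nu> that by (auto simp: cell_def a_def)
      \<comment> \<open>Nonnegativity is needed because \<open>nat\<close> identifies all negative
        floors.\<close>
      moreover have "0 \<le> K * measure \<nu> (idx -` {i})" "0 \<le> K * measure \<nu>' (idx -` {i})" by auto
      ultimately have "\<bar>K * measure \<nu> (idx -` {i}) - K * measure \<nu>' (idx -` {i})\<bar> \<le> 1"
        by linarith
      then have "K * \<bar>measure \<nu> (idx -` {i}) - measure \<nu>' (idx -` {i})\<bar> \<le> 1"
        by (simp add: abs_mult flip: right_diff_distrib)
      then show ?thesis using K by (simp add: field_simps)
    qed
    have "W1 \<nu> \<nu>' \<le> ennreal (r + D * (\<Sum>i<n. \<bar>measure \<nu> (idx -` {i}) - measure \<nu>' (idx -` {i})\<bar>))"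
      using \<nu> r D idx_less idx_meas prod diam idx_in
      by (intro W1_le_of_partition) (auto simp: cell_def, metis)
    also have "\<dots> \<le> ennreal (r + D * (n / real K))"
      using D(1) sum_bounded_above[OF near, of "{..<n}"]
      by (intro ennreal_leI add_left_mono mult_left_mono) auto
    finally show "W1 \<nu> \<nu>' \<le> ennreal (r + D * (n / real K))" .
  qed
  then show ?thesis
    unfolding N_le_def using V cov card_image_le[OF V(1), of cell]
    by (intro cover_number_leI[of "cell ` V"]) auto
qed

lemma N_le_antimono:
  assumes "r \<le> r'"
  shows "N_le \<rho> Z r' \<le> N_le \<rho> Z r"
  unfolding N_le_def cover_number_def using assms
  by (intro INF_superset_mono) (auto intro: order_trans ennreal_leI)

text \<open>The default value 0 of \<open>lnln\<close> at 0 and 1 exceeds its value at 2, so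
  \<open>lnln\<close> is not monotone. From \<open>M >= 3\<close> on, \<open>ln (ln M)\<close> is
  positive and dominates the default too.\<close>

lemma lnln_le:
  assumes "N \<le> enat M" "3 \<le> M"
  shows "lnln N \<le> ereal (ln (ln M))"
proof -
  obtain n where n: "N = enat n" "n \<le> M" using assms(1) by (cases N) auto
  have "1 < ln (3 :: real)"
    using ln_less_cancel_iff[of "exp 1" "3::real"] e_less_272 by simp
  moreover have "ln 3 \<le> ln (real M)" using assms(2) by simp
  ultimately have M: "1 < ln (real M)" by linarith
  show ?thesis
  proof (cases "n \<le> 1")
    case True
    then have "n = 0 \<or> n = 1" by auto
    then show ?thesis using n M by (auto simp: lnln_def)
  next
    case False
    then show ?thesis using n M by (auto simp: lnln_def)
  qed
qed

lemma lnln_ge: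
  assumes "1 < y" "ereal y \<le> ereal_of_enat N"
  shows "ereal (ln (ln y)) \<le> lnln N"
  using assms by (cases N) (auto simp: lnln_def)

lemma lnln_ge_const: "ereal (ln (ln 2)) \<le> lnln N"
proof (cases N)
  case (enat n)
  have "ln (ln 2 :: real) \<le> 0"
    using ln_2_less_1 by simp
  moreover have "n = 0 \<or> n = 1 \<or> n \<ge> 2" by auto
  ultimately show ?thesis using enat by (auto simp: lnln_def)
qed (simp add: lnln_def)

subsection \<open>Dimensions\<close>

text \<open>The numerator is bounded below by the negative constant \<open>ln (ln 2)\<close>, while
  the denominator tends to infinity.\<close>

lemma LCD_nonneg: "0 \<le> LCD \<rho> Z"
proof -
  have "((\<lambda>r::real. ln (ln 2) / ln (1 / r)) \<longlongrightarrow> 0) (at_right 0)"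
    by real_asymp
  then have "((\<lambda>r::real. ereal (ln (ln 2) / ln (1 / r))) \<longlongrightarrow> ereal 0) (at_right 0)"
    by (rule tendsto_ereal)
  then have "0 = Limsup (at_right 0) (\<lambda>r::real. ereal (ln (ln 2) / ln (1 / r)))"
    by (metis lim_imp_Limsup trivial_limit_at_right_real zero_ereal_def)
  also have "\<dots> \<le> LCD \<rho> Z"
    unfolding LCD_def
  proof (rule Limsup_mono)
    show "\<forall>\<^sub>F r::real in at_right 0.
        ereal (ln (ln 2) / ln (1 / r)) \<le> lnln (N_le \<rho> Z r) / ereal (ln (1 / r))"
      using eventually_at_right_real[of 0 "1::real", simplified]
    proof eventually_elim
      case (elim r)
      then have "0 < ln (1 / r)" by (intro ln_gt_zero) auto
      then show ?case
        using ereal_divide_right_mono[OF lnln_ge_const, of "ereal (ln (1 / r))"] by simp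
    qed
  qed
  finally show ?thesis .
qed

text \<open>One point from each set of a finite cover gives a finite net, so the space is totally
  bounded and has a countable basis.\<close>

lemma sets_borel_prod_if_finite_covers:
  assumes "\<And>r. 0 < r \<Longrightarrow> r \<le> 1 \<Longrightarrow> N_less (\<lambda>x y :: 'a::metric_space. ennreal (dist x y)) UNIV r \<noteq> \<infinity>"
  shows "sets (borel \<Otimes>\<^sub>M borel) = sets (borel :: ('a \<times> 'a) measure)"
proof -
  have "\<exists>T. finite T \<and> (\<forall>x::'a. \<exists>y\<in>T. dist x y < e)" if "e > 0" for e
  proof -
    have "N_less (\<lambda>x y :: 'a. ennreal (dist x y)) UNIV (min e 1) \<noteq> \<infinity>"
      using that by (intro assms) auto
    then obtain n where "N_less (\<lambda>x y :: 'a. ennreal (dist x y)) UNIV (min e 1) \<le> enat n"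
      by (metis not_enat_eq order_refl)
    from cover_number_leE[OF this[unfolded N_less_def]]
    obtain C :: "'a set set" where C: "finite C" "\<Union>C = UNIV"
      "\<And>S. S \<in> C \<Longrightarrow> ediam (\<lambda>x y. ennreal (dist x y)) S < ennreal (min e 1)" by metis
    \<comment> \<open>An empty member of the cover contributes an arbitrary point, which does no
      harm.\<close>
    define T where "T = (\<lambda>S. SOME y. y \<in> S) ` C"
    have "\<exists>y\<in>T. dist x y < e" for x
    proof -
      obtain S where S: "S \<in> C" "x \<in> S" using C(2) by blast
      let ?y = "SOME y. y \<in> S"
      have "?y \<in> S" using S(2) by (rule someI)
      then have "ennreal (dist x ?y) \<le> ediam (\<lambda>x y. ennreal (dist x y)) S"
        using S by (intro ediam_leD[of "\<lambda>x y. ennreal (dist x y)" S]) auto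
      also have "\<dots> < ennreal (min e 1)" using C(3) S(1) by blast
      finally have "dist x ?y < e" by (simp add: ennreal_less_iff)
      then show ?thesis using S(1) by (auto simp: T_def)
    qed
    then show ?thesis using C(1) by (intro exI[of _ T]) (auto simp: T_def)
  qed
  then obtain B :: "'a set set" where "countable B" "topological_basis B"
    using countable_basis_if_totally_bounded by blast
  then show ?thesis using sets_borel_prod_countable_basis by blast
qed

lemma LCD_W1_le:
  assumes bdd: "bounded (UNIV :: 'a::metric_space set)" and d: "0 < d"
    and c: "\<And>r. 0 < r \<Longrightarrow> r \<le> 1 \<Longrightarrow>
      ereal_of_enat (N_less (\<lambda>x y :: 'a. ennreal (dist x y)) UNIV r) \<le> ereal (c * r powr (- d))"
  shows "LCD W1 (prob_measures :: 'a measure set) \<le> ereal d"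
proof -
  \<comment> \<open>The 3 ensures \<open>\<beta> r >= 3\<close> for \<open>r <= 1\<close>, so that
    \<open>n >= 3\<close> below and the iterated logarithms are of positive size.\<close>
  define b where "b = max c 3"
  define \<beta> where "\<beta> r = b * r powr (- d)" for r
  have N: "ereal_of_enat (N_less (\<lambda>x y :: 'a. ennreal (dist x y)) UNIV r) \<le> ereal (\<beta> r)"
    if "0 < r" "r \<le> 1" for r
  proof -
    have "c * r powr (- d) \<le> \<beta> r" unfolding \<beta>_def b_def by (intro mult_right_mono) auto
    then show ?thesis using c[OF that] by (meson ereal_less_eq(3) order_trans)
  qed
  have "N_less (\<lambda>x y :: 'a. ennreal (dist x y)) UNIV r \<noteq> \<infinity>" if "0 < r" "r \<le> 1" for r
    using N[OF that] by (cases "N_less (\<lambda>x y :: 'a. ennreal (dist x y)) UNIV r") auto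
  then have prod: "sets (borel \<Otimes>\<^sub>M borel) = sets (borel :: ('a \<times> 'a) measure)"
    by (rule sets_borel_prod_if_finite_covers)
  obtain D where D: "0 \<le> D" "\<And>x y :: 'a. dist x y \<le> D"
  proof -
    obtain D' where D': "\<forall>x\<in>UNIV. \<forall>y\<in>UNIV. dist x (y :: 'a) \<le> D'"
      using bdd unfolding bounded_two_points by blast
    show ?thesis by (rule that[of "max D' 0"]) (use D' in \<open>auto simp: le_max_iff_disj\<close>)
  qed
  \<comment> \<open>With \<open>K >= n / r\<close> the covering scale \<open>r + D * (n / K)\<close>
    is at most \<open>E * r\<close>. Scale \<open>x\<close> is therefore reached with
    \<open>r = x / E\<close>.\<close>
  define E where "E = 1 + D"
  have E: "E \<ge> 1" using D by (simp add: E_def)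
  have key: "lnln (N_le W1 (prob_measures :: 'a measure set) (E * r)) \<le>
      ereal (ln (\<beta> r * ln (\<beta> r / r + 2)))" if r: "0 < r" "r \<le> 1" for r
  proof -
    define n where "n = nat \<lfloor>\<beta> r\<rfloor>"
    define K where "K = nat \<lceil>n / r\<rceil>"
    have "1 \<le> r powr (- d)" using r d by (simp add: powr_minus powr_le1 one_le_inverse_iff)
    then have "3 * 1 \<le> \<beta> r" unfolding \<beta>_def b_def by (intro mult_mono) auto
    then have n: "3 \<le> n" "real n \<le> \<beta> r" "\<beta> r < real n + 1" unfolding n_def by linarith+
    have nr: "real n \<le> n / r" using r by (simp add: pos_le_divide_eq mult_left_le)
    then have K: "n / r \<le> K" "K \<le> n / r + 1" "1 \<le> K" unfolding K_def using n(1) by linarith+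
    have "N_less (\<lambda>x y :: 'a. ennreal (dist x y)) UNIV r \<le> enat n"
      using N[OF r] n by (cases "N_less (\<lambda>x y :: 'a. ennreal (dist x y)) UNIV r") auto
    then have "N_le W1 (prob_measures :: 'a measure set) (r + D * (n / real K)) \<le> enat ((K + 1) ^ n)"
      using r prod D K(3) by (intro W1_covering_number_le) auto
    moreover have "n / real K \<le> r" using K r by (simp add: field_simps)
    then have "r + D * (n / real K) \<le> E * r"
      using D mult_left_mono[of "n / real K" r D] by (simp add: E_def algebra_simps)
    ultimately have "N_le W1 (prob_measures :: 'a measure set) (E * r) \<le> enat ((K + 1) ^ n)"
      using N_le_antimono order_trans by blast
    moreover have K3: "(3::nat) \<le> (K + 1) ^ n"
    proof -
      have "(3::nat) \<le> 2 ^ 3" by simp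
      also have "\<dots> \<le> (K + 1) ^ 3" using K(3) by (intro power_mono) auto
      also have "\<dots> \<le> (K + 1) ^ n" using n(1) by (intro power_increasing) auto
      finally show ?thesis .
    qed
    ultimately have "lnln (N_le W1 (prob_measures :: 'a measure set) (E * r)) \<le>
        ereal (ln (ln (real ((K + 1) ^ n))))"
      by (intro lnln_le)
    also have "ln (real ((K + 1) ^ n)) = n * ln (real K + 1)"
      by (simp add: ln_realpow add.commute)
    also have "ereal (ln (n * ln (real K + 1))) \<le> ereal (ln (\<beta> r * ln (\<beta> r / r + 2)))"
    proof -
      have "n / r \<le> \<beta> r / r" using n(2) r by (simp add: divide_right_mono)
      then have "real K + 1 \<le> \<beta> r / r + 2" using K(2) by linarith
      then have "n * ln (real K + 1) \<le> \<beta> r * ln (\<beta> r / r + 2)"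
        using n K(3) by (intro mult_mono) auto
      moreover have "0 < n * ln (real K + 1)" using n(1) K(3) by simp
      ultimately show ?thesis by simp
    qed
    finally show ?thesis .
  qed
  \<comment> \<open>The numerator is \<open>d * ln (1 / x)\<close> plus a term of order
    \<open>ln (ln (1 / x))\<close>: the number of rounding levels enters only through the inner
    logarithm.\<close>
  have "((\<lambda>x::real. ln (\<beta> (x / E) * ln (\<beta> (x / E) / (x / E) + 2)) / ln (1 / x)) \<longlongrightarrow> d) (at_right 0)"
  proof -
    have "b > 0" "E > 0" using E by (auto simp: b_def)
    then show ?thesis unfolding \<beta>_def using d by real_asymp
  qed
  then have "((\<lambda>x::real. ereal (ln (\<beta> (x / E) * ln (\<beta> (x / E) / (x / E) + 2)) / ln (1 / x)))
      \<longlongrightarrow> ereal d) (at_right 0)"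
    by (rule tendsto_ereal)
  then have "ereal d = Limsup (at_right 0)
      (\<lambda>x::real. ereal (ln (\<beta> (x / E) * ln (\<beta> (x / E) / (x / E) + 2)) / ln (1 / x)))"
    by (rule lim_imp_Limsup[OF trivial_limit_at_right_real, symmetric])
  moreover have "LCD W1 (prob_measures :: 'a measure set) \<le> \<dots>"
    unfolding LCD_def
  proof (rule Limsup_mono)
    show "\<forall>\<^sub>F x::real in at_right 0. lnln (N_le W1 (prob_measures :: 'a measure set) x) / ereal (ln (1 / x))
        \<le> ereal (ln (\<beta> (x / E) * ln (\<beta> (x / E) / (x / E) + 2)) / ln (1 / x))"
      using eventually_at_right_real[of 0 "1::real", simplified]
    proof eventually_elim
      case (elim x)
      then have "0 < ln (1 / x)" by (intro ln_gt_zero) auto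
      moreover have "x / E \<le> 1" using elim E by (simp add: field_simps)
      ultimately show ?case
        using ereal_divide_right_mono[OF key[of "x / E"], of "ereal (ln (1 / x))"] elim E by simp
    qed
  qed
  ultimately show ?thesis by simp
qed

lemma N_less_antimono:
  assumes "r \<le> r'"
  shows "N_less \<rho> Z r' \<le> N_less \<rho> Z r"
  unfolding N_less_def cover_number_def using assms
  by (intro INF_superset_mono) (auto intro: order_less_le_trans ennreal_leI)

text \<open>If the dimension were below some \<open>e < d\<close>, the quotient \<open>?f\<close>
  would be below \<open>e\<close> at all small scales, and the explicit function \<open>?g\<close>
  above \<open>e\<close>. A scale at which the covering number exceeds
  \<open>c * r powr (- d)\<close> for a suitable \<open>c\<close> forces
  \<open>?g <= ?f\<close>.\<close>

lemma LCD_W1_ge: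
  assumes d: "0 \<le> d"
    and fin: "\<And>r. 0 < r \<Longrightarrow> r \<le> 1 \<Longrightarrow> N_less (\<lambda>x y :: 'a::metric_space. ennreal (dist x y)) UNIV r \<noteq> \<infinity>"
    and large: "\<And>c. \<exists>r. 0 < r \<and> r \<le> 1 \<and>
      ereal (c * r powr (- d)) < ereal_of_enat (N_less (\<lambda>x y :: 'a. ennreal (dist x y)) UNIV r)"
  shows "ereal d \<le> LCD W1 (prob_measures :: 'a measure set)"
proof (rule ccontr)
  let ?N = "N_less (\<lambda>x y :: 'a. ennreal (dist x y)) UNIV"
  let ?f = "\<lambda>x::real. lnln (N_le W1 (prob_measures :: 'a measure set) x) / ereal (ln (1 / x))"
  \<comment> \<open>From \<open>n >= r powr (- d)\<close> points one gets
    \<open>ln (ln ((10/9) ^ n)) = ln n + ln (ln (10/9))\<close>, at scale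
    \<open>x = r / 64\<close>.\<close>
  let ?g = "\<lambda>x::real. (d * ln (1 / (64 * x)) + ln (ln (10/9))) / ln (1 / x)"
  assume "\<not> ereal d \<le> LCD W1 (prob_measures :: 'a measure set)"
  then obtain e where e: "LCD W1 (prob_measures :: 'a measure set) < ereal e" "e < d"
    by (metis ereal_dense2 ereal_less_eq(3) not_le)
  have "(?g \<longlongrightarrow> d) (at_right 0)" by real_asymp
  then have "\<forall>\<^sub>F x in at_right 0. e < ?g x" using e(2) by (rule order_tendstoD)
  moreover have "\<forall>\<^sub>F x in at_right 0. ?f x < ereal e"
    using e(1) unfolding LCD_def by (rule Limsup_lessD)
  ultimately have "\<forall>\<^sub>F x in at_right 0. e < ?g x \<and> ?f x < ereal e" by eventually_elim simp
  then obtain b where b: "b > 0" "\<And>x. 0 < x \<Longrightarrow> x < b \<Longrightarrow> e < ?g x \<and> ?f x < ereal e"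
    unfolding eventually_at_right_field by blast
  define b' where "b' = min b 1"
  have b': "0 < b'" "b' \<le> 1" "b' \<le> b" using b(1) by (auto simp: b'_def)
  obtain M where M: "?N b' = enat M" using fin[OF b'(1,2)] by auto
  \<comment> \<open>The hypothesis \<open>large\<close> gives a scale in \<open>(0, 1]\<close> that
    need not be small. A constant above the covering number \<open>M\<close> at \<open>b'\<close>
    forces \<open>r < b'\<close>; the summand 2 compensates for passing from \<open>N\<close> to
    \<open>N - 1\<close>.\<close>
  obtain r where r: "0 < r" "r \<le> 1" "ereal ((M + 2) * r powr (- d)) < ereal_of_enat (?N r)"
    using large by blast
  obtain N where N: "?N r = enat N" using fin[OF r(1,2)] by auto
  have pw: "1 \<le> r powr (- d)" using r d by (simp add: powr_minus powr_le1 one_le_inverse_iff)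
  have N1: "(M + 2) * r powr (- d) < N" using r(3) N by simp
  have "r < b'"
  proof (rule ccontr)
    assume "\<not> r < b'"
    then have "?N r \<le> ?N b'" by (intro N_less_antimono) simp
    then have "real N \<le> M" using M N by simp
    also have "\<dots> < real (M + 2) * 1" by simp
    also have "\<dots> \<le> (M + 2) * r powr (- d)" using pw by (intro mult_left_mono) auto
    finally show False using N1 by simp
  qed
  define n where "n = N - 1"
  have "2 * r powr (- d) \<le> (M + 2) * r powr (- d)" by (intro mult_right_mono) auto
  then have "2 * r powr (- d) < N" using N1 by linarith
  then have n: "r powr (- d) \<le> n" "n \<ge> 1" "n < N" using pw unfolding n_def by linarith+
  obtain P :: "'a set" where P: "finite P" "card P = Suc n"
    "\<forall>x\<in>P. \<forall>y\<in>P. x \<noteq> y \<longrightarrow> r / 4 \<le> dist x y"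
    using separated_set_exists[OF r(1), of n, where 'a = 'a] n(3) N by auto
  \<comment> \<open>The points are \<open>r / 4\<close> apart and the counting bound works at one
    sixteenth of the separation.\<close>
  define x where "x = r / 64"
  have x: "0 < x" "x < b" "x < 1" "r = 64 * x"
    using r \<open>r < b'\<close> b' by (auto simp: x_def)
  have "ereal ((10/9) ^ n) \<le> ereal_of_enat (N_le W1 (prob_measures :: 'a measure set) x)"
  proof (cases "N_le W1 (prob_measures :: 'a measure set) x")
    case (enat k)
    then have "cover_number (\<lambda>S. ediam W1 S \<le> ennreal x) (prob_measures :: 'a measure set) \<le> enat k"
      by (simp add: N_le_def)
    from cover_number_leE[OF this] obtain C where C: "finite C"
      "\<Union>C = (prob_measures :: 'a measure set)" "\<And>S. S \<in> C \<Longrightarrow> ediam W1 S \<le> ennreal x" "card C \<le> k"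
      by metis
    have "(10/9) ^ n \<le> real (card C)"
      using P n r C by (intro card_W1_cover_ge[of P n "r / 4"]) (auto simp: x_def)
    then show ?thesis using enat C(4) by simp
  qed simp
  then have "ereal (ln (ln ((10/9) ^ n))) \<le> lnln (N_le W1 (prob_measures :: 'a measure set) x)"
    using n(2) by (intro lnln_ge) (auto intro: one_less_power)
  moreover have "d * ln (1 / (64 * x)) + ln (ln (10/9)) \<le> ln (ln ((10/9) ^ n))"
  proof -
    have l: "0 < ln (10/9 :: real)" by simp
    have "d * ln (1 / (64 * x)) + ln (ln (10/9)) = ln (r powr (- d) * ln (10/9))"
      using r(1) l unfolding x(4)[symmetric] by (simp only: ln_div ln_one ln_mult ln_powr) simp
    also have "\<dots> \<le> ln (n * ln (10/9))"
    proof (rule ln_mono)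
      show "0 < r powr (- d) * ln (10/9)" using l pw by (intro mult_pos_pos) auto
      show "r powr (- d) * ln (10/9) \<le> n * ln (10/9)" using l n(1) by (intro mult_right_mono) auto
    qed
    finally show ?thesis by (simp add: ln_realpow)
  qed
  ultimately have "ereal (d * ln (1 / (64 * x)) + ln (ln (10/9))) \<le>
      lnln (N_le W1 (prob_measures :: 'a measure set) x)"
    by (meson ereal_less_eq(3) order_trans)
  moreover have "0 < ln (1 / x)" using x by (intro ln_gt_zero) auto
  ultimately have "ereal (d * ln (1 / (64 * x)) + ln (ln (10/9))) / ereal (ln (1 / x)) \<le> ?f x"
    by (intro ereal_divide_right_mono) auto
  then have "ereal (?g x) \<le> ?f x" using \<open>0 < ln (1 / x)\<close> by simp
  moreover have "ereal e < ereal (?g x)" "?f x < ereal e" using b(2)[OF x(1,2)] by auto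
  ultimately show False by (meson less_le_trans not_less_iff_gr_or_eq)
qed

theorem theoremD1:
  fixes \<kappa> :: real
  assumes "bounded (UNIV :: 'a::metric_space set)"
    and "COV (\<lambda>x y :: 'a. ennreal (dist x y)) UNIV = ereal \<kappa>"
  shows "LCD W1 (prob_measures :: 'a measure set) = ereal \<kappa>"
proof -
  let ?N = "N_less (\<lambda>x y :: 'a. ennreal (dist x y)) UNIV"
  define S where "S = {d. 0 \<le> d \<and>
     (\<exists>c. \<forall>r. 0 < r \<and> r \<le> 1 \<longrightarrow> ereal_of_enat (?N r) \<le> ereal (c * r powr (- d)))}"
  have inf: "Inf (ereal ` S) = ereal \<kappa>" using assms(2) by (simp add: COV_def S_def)
  have "0 \<le> Inf (ereal ` S)" by (intro Inf_greatest) (auto simp: S_def)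
  then have \<kappa>: "0 \<le> \<kappa>" using inf by simp
  \<comment> \<open>The infimum need not be attained, so an admissible exponent \<open>d'\<close>
    below \<open>d\<close> is taken. For \<open>r <= 1\<close> its bound also holds with exponent
    \<open>d\<close>.\<close>
  have up: "LCD W1 (prob_measures :: 'a measure set) \<le> ereal d" if "\<kappa> < d" for d
  proof -
    have "Inf (ereal ` S) < ereal d" using inf that by simp
    then obtain d' where d': "d' \<in> S" "d' < d" by (auto simp: Inf_less_iff)
    then obtain c where c: "\<And>r. 0 < r \<Longrightarrow> r \<le> 1 \<Longrightarrow> ereal_of_enat (?N r) \<le> ereal (c * r powr (- d'))"
      by (auto simp: S_def)
    show ?thesis
    proof (rule LCD_W1_le[OF assms(1), of d "max c 0"])
      fix r :: real assume r: "0 < r" "r \<le> 1"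
      have "c * r powr (- d') \<le> max c 0 * r powr (- d)"
        using r d' by (intro mult_mono powr_mono') auto
      then show "ereal_of_enat (?N r) \<le> ereal (max c 0 * r powr (- d))"
        using c[OF r] by (meson ereal_less_eq(3) order_trans)
    qed (use \<kappa> that in simp)
  qed
  \<comment> \<open>The infimum of the empty set would be infinite. Any admissible exponent makes
    all covering numbers at scales up to 1 finite.\<close>
  have "S \<noteq> {}" using inf by (auto simp: top_ereal_def)
  then obtain d c where "\<And>r. 0 < r \<Longrightarrow> r \<le> 1 \<Longrightarrow> ereal_of_enat (?N r) \<le> ereal (c * r powr (- d))"
    by (auto simp: S_def)
  then have fin: "?N r \<noteq> \<infinity>" if "0 < r" "r \<le> 1" for r
    using that by (metis ereal_infty_less_eq(1) ereal_of_enat_simps(2) PInfty_neq_ereal(1))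
  have low: "ereal d \<le> LCD W1 (prob_measures :: 'a measure set)" if "d < \<kappa>" for d
  proof (cases "0 \<le> d")
    case True
    \<comment> \<open>An exponent below the infimum is not admissible, which is the hypothesis
      \<open>large\<close> of \<open>LCD_W1_ge\<close>.\<close>
    have "d \<notin> S"
    proof
      assume "d \<in> S"
      then have "Inf (ereal ` S) \<le> ereal d" by (intro Inf_lower) auto
      then show False using inf that by simp
    qed
    then show ?thesis
      using True fin by (intro LCD_W1_ge) (auto simp: S_def not_le)
  next
    \<comment> \<open>For \<open>\<kappa> = 0\<close> this is the only case that occurs.\<close>
    case False
    then have "ereal d \<le> 0" by simp
    then show ?thesis using LCD_nonneg order_trans by blast
  qed
  show ?thesis
  proof (rule antisym)
    show "LCD W1 (prob_measures :: 'a measure set) \<le> ereal \<kappa>"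
      using up by (metis ereal_dense2 less_ereal.simps(1) not_le)
    show "ereal \<kappa> \<le> LCD W1 (prob_measures :: 'a measure set)"
      using low by (metis ereal_dense2 less_ereal.simps(1) not_le)
  qed
qed

end
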